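(* Let $p:[0,1]\to(1,+\infty)$ be continuous, let $p^-:=\min_{t\in[0,1]}p(t)$, and fix $q\in(1,p^-)$. Then for every $u\in L^{p(\cdot)}\big((0,1)\big)$, $$\|u\|_{L^{\frac{p(\cdot)}{q}}}\le\|u\|_{L^{p(\cdot)}}.$$
   Context: For a continuous exponent $r:[0,1]\to(1,+\infty)$, $L^{r(\cdot)}$ is the variable exponent Lebesgue space on the unit interval with Luxemburg norm $\|u\|_{L^{r(\cdot)}}:=\inf\{\delta>0:\int_0^1|u(x)/\delta|^{r(x)}\,dx\le1\}$; $L^{\frac{p(\cdot)}q}$ corresponds to $r(t)=p(t)/q$. *)

theory Defs
  imports "HOL-Analysis.Analysis"
begin

definition var_modular :: "(real \<Rightarrow> real) \<Rightarrow> (real \<Rightarrow> real) \<Rightarrow> ennreal" where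
  "var_modular r u =
     (\<integral>\<^sup>+ x. ennreal (\<bar>u x\<bar> powr r x) \<partial>lebesgue_on {0<..<1})"

text \<open>
  Elements of the space are represented by functions (not by classes modulo equality almost
  everywhere); only the values on the open unit interval matter.  For a bounded exponent, in
  particular for one that is continuous on the closed interval, finiteness of the modular of
  some multiple of \<open>u\<close> is the same as finiteness of the modular of \<open>u\<close>.
\<close>
definition var_Lebesgue :: "(real \<Rightarrow> real) \<Rightarrow> (real \<Rightarrow> real) set" where
  "var_Lebesgue r =
     {u. u \<in> borel_measurable (lebesgue_on {0<..<1}) \<and>
         (\<exists>\<delta>>0. var_modular r (\<lambda>x. u x / \<delta>) < \<infinity>)}"

text \<open>
  The Luxemburg norm takes values in the extended nonnegative reals, so that the infimum of the
  empty set is \<open>\<infinity>\<close>.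
\<close>
definition luxemburg_norm :: "(real \<Rightarrow> real) \<Rightarrow> (real \<Rightarrow> real) \<Rightarrow> ennreal" where
  "luxemburg_norm r u =
     Inf {ennreal \<delta> | \<delta>. \<delta> > 0 \<and> var_modular r (\<lambda>x. u x / \<delta>) \<le> 1}"

definition exponent_min :: "(real \<Rightarrow> real) \<Rightarrow> real" where
  "exponent_min p = (LEAST y. y \<in> p ` {0..1})"

lemma exponent_min_attained:
  assumes "continuous_on {0..1} p"
  shows "exponent_min p \<in> p ` {0..1}" "\<And>t. t \<in> {0..1} \<Longrightarrow> exponent_min p \<le> p t"
proof -
  obtain t0 where t0: "t0 \<in> {0..1}" "\<And>t. t \<in> {0..1} \<Longrightarrow> p t0 \<le> p t"
    using continuous_attains_inf[OF compact_Icc _ assms] by force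
  have "exponent_min p = p t0"
    unfolding exponent_min_def by (rule Least_equality) (use t0 in auto)
  then show "exponent_min p \<in> p ` {0..1}" "\<And>t. t \<in> {0..1} \<Longrightarrow> exponent_min p \<le> p t"
    using t0 by auto
qed

end

theory Submission
  imports Defs
begin

text \<open>
  Young's inequality gives \<open>a powr (p t / q) \<le> a powr p t / q + (1 - 1 / q)\<close>.  Since the unit
  interval has measure 1, integration shows that \<open>u / \<delta>\<close> has modular at most 1 for the exponent
  \<open>p / q\<close> whenever it has modular at most 1 for \<open>p\<close>, so the infimum defining the norm can
  only drop.
\<close>

text \<open>Tangent-line bound at \<open>y = 1\<close> for the concave map
  \<open>y powr (1 / q)\<close>, taken at \<open>y = a powr s\<close>.\<close>

lemma powr_divide_le_convex:
  fixes a s q :: real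
  assumes "1 \<le> q" "0 \<le> a"
  shows "a powr (s / q) \<le> (1 / q) * a powr s + (1 - 1 / q)"
proof (cases "a = 0")
  case True
  \<comment> \<open>Young's inequality is applied to positive bases, so zero is separate:
    \<open>0 powr s = 0\<close> for every \<open>s\<close>, and \<open>1 - 1 / q\<close> is
    nonnegative.\<close>
  then show ?thesis using assms by simp
next
  case False
  then have "(a powr s) powr (1 / q) * 1 powr (1 - 1 / q) \<le> (1 / q) * a powr s + (1 - 1 / q) * 1"
    using assms by (intro Youngs_inequality_0) auto
  then show ?thesis by (simp add: powr_powr)
qed

lemma var_modular_divide_le:
  fixes r v :: "real \<Rightarrow> real" and q :: real
  assumes r: "r \<in> borel_measurable (lebesgue_on {0<..<1})"
    and v: "v \<in> borel_measurable (lebesgue_on {0<..<1})"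
    and q: "1 \<le> q"
  shows "var_modular (\<lambda>t. r t / q) v \<le> ennreal (1 / q) * var_modular r v + ennreal (1 - 1 / q)"
proof -
  let ?M = "lebesgue_on {0<..<1::real}"
  have [measurable]: "(\<lambda>x. \<bar>v x\<bar> powr r x) \<in> borel_measurable ?M"
    using r v by measurable
  \<comment> \<open>Total mass 1 makes the constant \<open>1 - 1 / q\<close> integrate to
    itself.\<close>
  have mass: "emeasure ?M (space ?M) = 1"
    by (simp add: emeasure_restrict_space space_restrict_space)
  have "var_modular (\<lambda>t. r t / q) v
      \<le> (\<integral>\<^sup>+ x. ennreal (1 / q) * ennreal (\<bar>v x\<bar> powr r x) + ennreal (1 - 1 / q) \<partial>?M)"
    unfolding var_modular_def
  proof (rule nn_integral_mono)
    fix x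
    have "ennreal (\<bar>v x\<bar> powr (r x / q)) \<le> ennreal ((1 / q) * \<bar>v x\<bar> powr r x + (1 - 1 / q))"
      using q by (intro ennreal_leI powr_divide_le_convex) auto
    also have "\<dots> = ennreal (1 / q) * ennreal (\<bar>v x\<bar> powr r x) + ennreal (1 - 1 / q)"
      using q by (subst ennreal_plus) (auto simp flip: ennreal_mult)
    finally show "ennreal (\<bar>v x\<bar> powr (r x / q))
      \<le> ennreal (1 / q) * ennreal (\<bar>v x\<bar> powr r x) + ennreal (1 - 1 / q)" .
  qed
  also have "\<dots> = ennreal (1 / q) * var_modular r v + ennreal (1 - 1 / q)"
    using mass unfolding var_modular_def by (simp add: nn_integral_add nn_integral_cmult)
  finally show ?thesis .
qed

text \<open>Every \<delta> admissible for \<open>r\<close> is admissible for \<open>r / q\<close>,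
  because the modular bound is a convex combination of the old modular and 1.\<close>

lemma luxemburg_norm_divide_le:
  fixes r u :: "real \<Rightarrow> real" and q :: real
  assumes r: "r \<in> borel_measurable (lebesgue_on {0<..<1})"
    and u: "u \<in> borel_measurable (lebesgue_on {0<..<1})"
    and q: "1 \<le> q"
  shows "luxemburg_norm (\<lambda>t. r t / q) u \<le> luxemburg_norm r u"
proof -
  have "var_modular (\<lambda>t. r t / q) (\<lambda>x. u x / \<delta>) \<le> 1"
    if "var_modular r (\<lambda>x. u x / \<delta>) \<le> 1" for \<delta>
  proof -
    have "var_modular (\<lambda>t. r t / q) (\<lambda>x. u x / \<delta>)
        \<le> ennreal (1 / q) * var_modular r (\<lambda>x. u x / \<delta>) + ennreal (1 - 1 / q)"
      using r u q by (intro var_modular_divide_le) auto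
    also have "\<dots> \<le> ennreal (1 / q) * 1 + ennreal (1 - 1 / q)"
      using that by (intro add_mono mult_left_mono) auto
    also have "\<dots> = 1"
      using q by (simp flip: ennreal_plus)
    finally show ?thesis .
  qed
  \<comment> \<open>The infimum over the larger set of admissible \<delta> is smaller; if no
    \<delta> is admissible for \<open>r\<close>, the right-hand side is \<infinity>.\<close>
  then show ?thesis
    unfolding luxemburg_norm_def by (intro Inf_superset_mono) auto
qed

theorem lemma2p15:
  fixes p u :: "real \<Rightarrow> real" and q :: real
  assumes "continuous_on {0..1} p"
    and "\<And>t. t \<in> {0..1} \<Longrightarrow> 1 < p t"
    and "1 < q" and "q < exponent_min p"
    and "u \<in> var_Lebesgue p"
  shows "luxemburg_norm (\<lambda>t. p t / q) u \<le> luxemburg_norm p u"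
proof (rule luxemburg_norm_divide_le)
  \<comment> \<open>Continuity of \<open>p\<close> enters through its measurability on the open
    interval.\<close>
  have "continuous_on {0<..<1} p"
    using assms(1) by (rule continuous_on_subset) auto
  then show "p \<in> borel_measurable (lebesgue_on {0<..<1})"
    by (rule continuous_imp_measurable_on_sets_lebesgue) auto
  show "u \<in> borel_measurable (lebesgue_on {0<..<1})"
    using assms(5) by (simp add: var_Lebesgue_def)
  show "1 \<le> q"
    using assms(3) by simp
qed

end
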